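(* Let $(M,d)$ be a complete geodesic space which is uniformly $\infty$-convex. Then the following are equivalent: (1) $(M,d)$ is a $CAT(0)$-space; (2) $(M,d)$ is Busemann convex and satisfies the stable non-expansive projection property $(NE^* )$; (3) $(M,d)$ is Busemann convex and satisfies the stable symmetric orthogonality property $(SO^* )$.
   Context: Geodesics are maps $\gamma:[0,1]\to X$ with $\delta(\gamma_t,\gamma_s)=|t-s|\delta(\gamma_0,\gamma_1)$. Uniformly $\infty$-convex: there is $\rho:(0,\infty)\to(0,\infty)$ such that for all $\epsilon>0$ and $x,y,z$ with $d(y,z)>\epsilon\max\{d(x,y),d(x,z)\}$ and every midpoint $m$ of $y,z$, $d(x,m)\le(1-\rho(\epsilon))\max\{d(x,y),d(x,z)\}$. Busemann convex: for all geodesics $\gamma,\eta$ with $\gamma_0=\eta_0$, $d(\gamma_{1/2},\eta_{1/2})\le\frac12d(\gamma_1,\eta_1)$. $CAT(0)$: for all $x,y,z$ and a Euclidean triangle $\tilde x,\tilde y,\tilde z$ with the same side lengths, $d(x,m)\le\|\tilde x-\tilde m\|$ for the midpoints $m$ of $y,z$ and $\tilde m$ of $\tilde y,\tilde z$. In a geodesic space $(X,\delta)$: for $p=\gamma_0=\eta_0$, $\gamma\perp_p\eta$ means $\delta(p,\gamma_t)\le\delta(\eta_s,\gamma_t)$ for all $s,t$; $(SO)$ means $\gamma\perp_p\eta\Rightarrow\eta\perp_p\gamma$; $(NE)$ means for all closed weakly convex $C$ (any two points joined by some geodesic in $C$) and $x,y\in X$, $\delta(x_C,y_C)\le\delta(x,y)$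 for $x_C\in\pi_C(x)$, $y_C\in\pi_C(y)$, where $\pi_C(x)$ is the set of nearest points of $x$ in $C$. $(SO^* )$, resp. $(NE^* )$, means that $M\times_2\mathbb{R}$ ($M\times\mathbb{R}$ with $\tilde d((x,t),(y,s))^2=d(x,y)^2+|t-s|^2$) satisfies $(SO)$, resp. $(NE)$. *)

theory Defs
  imports "HOL-Analysis.Analysis"
begin

definition geodesic :: "'a set \<Rightarrow> ('a \<Rightarrow> 'a \<Rightarrow> real) \<Rightarrow> (real \<Rightarrow> 'a) \<Rightarrow> bool" where
  "geodesic M d \<gamma> \<longleftrightarrow> \<gamma> ` {0..1} \<subseteq> M \<and>
     (\<forall>s\<in>{0..1}. \<forall>t\<in>{0..1}. d (\<gamma> t) (\<gamma> s) = \<bar>t - s\<bar> * d (\<gamma> 0) (\<gamma> 1))"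

definition geodesic_space :: "'a set \<Rightarrow> ('a \<Rightarrow> 'a \<Rightarrow> real) \<Rightarrow> bool" where
  "geodesic_space M d \<longleftrightarrow> Metric_space M d \<and>
     (\<forall>x\<in>M. \<forall>y\<in>M. \<exists>\<gamma>. geodesic M d \<gamma> \<and> \<gamma> 0 = x \<and> \<gamma> 1 = y)"

definition is_midpoint :: "'a set \<Rightarrow> ('a \<Rightarrow> 'a \<Rightarrow> real) \<Rightarrow> 'a \<Rightarrow> 'a \<Rightarrow> 'a \<Rightarrow> bool" where
  "is_midpoint M d y z m \<longleftrightarrow> m \<in> M \<and> d y m = d y z / 2 \<and> d m z = d y z / 2"

definition uniformly_inf_convex :: "'a set \<Rightarrow> ('a \<Rightarrow> 'a \<Rightarrow> real) \<Rightarrow> bool" where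
  "uniformly_inf_convex M d \<longleftrightarrow> (\<exists>\<rho> :: real \<Rightarrow> real. (\<forall>\<epsilon>>0. \<rho> \<epsilon> > 0) \<and>
     (\<forall>\<epsilon>>0. \<forall>x\<in>M. \<forall>y\<in>M. \<forall>z\<in>M. d y z > \<epsilon> * max (d x y) (d x z) \<longrightarrow>
        (\<forall>m. is_midpoint M d y z m \<longrightarrow> d x m \<le> (1 - \<rho> \<epsilon>) * max (d x y) (d x z))))"

definition busemann_convex :: "'a set \<Rightarrow> ('a \<Rightarrow> 'a \<Rightarrow> real) \<Rightarrow> bool" where
  "busemann_convex M d \<longleftrightarrow> (\<forall>\<gamma> \<eta>. geodesic M d \<gamma> \<and> geodesic M d \<eta> \<and> \<gamma> 0 = \<eta> 0 \<longrightarrow>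
     d (\<gamma> (1/2)) (\<eta> (1/2)) \<le> d (\<gamma> 1) (\<eta> 1) / 2)"

definition CAT0 :: "'a set \<Rightarrow> ('a \<Rightarrow> 'a \<Rightarrow> real) \<Rightarrow> bool" where
  "CAT0 M d \<longleftrightarrow> (\<forall>x\<in>M. \<forall>y\<in>M. \<forall>z\<in>M. \<forall>x' y' z' :: real^2.
     dist x' y' = d x y \<and> dist x' z' = d x z \<and> dist y' z' = d y z \<longrightarrow>
     (\<forall>m. is_midpoint M d y z m \<longrightarrow> d x m \<le> dist x' (midpoint y' z')))"

definition orth :: "('a \<Rightarrow> 'a \<Rightarrow> real) \<Rightarrow> 'a \<Rightarrow> (real \<Rightarrow> 'a) \<Rightarrow> (real \<Rightarrow> 'a) \<Rightarrow> bool" where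
  "orth d p \<gamma> \<eta> \<longleftrightarrow> (\<forall>s\<in>{0..1}. \<forall>t\<in>{0..1}. d p (\<gamma> t) \<le> d (\<eta> s) (\<gamma> t))"

definition SO_prop :: "'a set \<Rightarrow> ('a \<Rightarrow> 'a \<Rightarrow> real) \<Rightarrow> bool" where
  "SO_prop M d \<longleftrightarrow> (\<forall>p \<gamma> \<eta>. geodesic M d \<gamma> \<and> geodesic M d \<eta> \<and> \<gamma> 0 = p \<and> \<eta> 0 = p \<and>
     orth d p \<gamma> \<eta> \<longrightarrow> orth d p \<eta> \<gamma>)"

definition weakly_convex :: "'a set \<Rightarrow> ('a \<Rightarrow> 'a \<Rightarrow> real) \<Rightarrow> 'a set \<Rightarrow> bool" where
  "weakly_convex M d C \<longleftrightarrow> C \<subseteq> M \<and>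
     (\<forall>x\<in>C. \<forall>y\<in>C. \<exists>\<gamma>. geodesic M d \<gamma> \<and> \<gamma> 0 = x \<and> \<gamma> 1 = y \<and> \<gamma> ` {0..1} \<subseteq> C)"

definition nearest_points :: "('a \<Rightarrow> 'a \<Rightarrow> real) \<Rightarrow> 'a set \<Rightarrow> 'a \<Rightarrow> 'a set" where
  "nearest_points d C x = {c \<in> C. \<forall>c'\<in>C. d x c \<le> d x c'}"

definition NE_prop :: "'a set \<Rightarrow> ('a \<Rightarrow> 'a \<Rightarrow> real) \<Rightarrow> bool" where
  "NE_prop M d \<longleftrightarrow> (\<forall>C. closedin (Metric_space.mtopology M d) C \<and> weakly_convex M d C \<longrightarrow>
     (\<forall>x\<in>M. \<forall>y\<in>M. \<forall>xC\<in>nearest_points d C x. \<forall>yC\<in>nearest_points d C y. d xC yC \<le> d x y))"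

definition l2_prod_dist :: "('a \<Rightarrow> 'a \<Rightarrow> real) \<Rightarrow> ('a \<times> real) \<Rightarrow> ('a \<times> real) \<Rightarrow> real" where
  "l2_prod_dist d p q = sqrt ((d (fst p) (fst q))\<^sup>2 + (snd p - snd q)\<^sup>2)"

definition SO_star :: "'a set \<Rightarrow> ('a \<Rightarrow> 'a \<Rightarrow> real) \<Rightarrow> bool" where
  "SO_star M d \<longleftrightarrow> SO_prop (M \<times> (UNIV :: real set)) (l2_prod_dist d)"

definition NE_star :: "'a set \<Rightarrow> ('a \<Rightarrow> 'a \<Rightarrow> real) \<Rightarrow> bool" where
  "NE_star M d \<longleftrightarrow> NE_prop (M \<times> (UNIV :: real set)) (l2_prod_dist d)"

end

theory Submission
  imports Defs
begin

text \<open>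
  \<open>CAT(0)\<close> is equivalent to the Bruhat--Tits inequality \<open>CN\<close>, which passes to the product with the
  line; there, a point of a geodesic nearest to \<open>x\<close> satisfies one half of Pythagoras' theorem, and this
  yields symmetric orthogonality and (with the four-point inequality) non-expansive projections.
  A projection onto the image of a geodesic shows that \<open>NE\<close> implies \<open>SO\<close>.

  Conversely, let \<open>\<gamma>\<close> be a geodesic ending in \<open>q\<close>, let \<open>x\<close> be a point and let \<open>F(t)\<close> be the squared
  distance from \<open>x\<close> to \<open>\<gamma>\<^sub>t\<close>. Tilting geodesics in the product turns \<open>SO\<^sup>*\<close> into a
  symmetry of first variations: a lower bound for the slope of \<open>F\<close> at \<open>p = \<gamma>\<^sub>t\<close> is also a lower bound for
  the slope at \<open>p\<close> of the squared distance to \<open>q\<close> along the geodesic from \<open>p\<close> to \<open>x\<close>. By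
  Busemann convexity the geodesics from \<open>p\<close> and from \<open>p' = \<gamma>\<^sub>s\<close> to \<open>x\<close> approach each other linearly, so that
  the latter slope grows in \<open>t\<close> at the Euclidean rate. Hence so does the slope of \<open>F\<close>, and integrating it
  from the midpoint of \<open>\<gamma>\<close> towards both ends gives \<open>CN\<close>.
\<close>

section \<open>The CN inequality and Euclidean comparison triangles\<close>

definition CN :: "'a set \<Rightarrow> ('a \<Rightarrow> 'a \<Rightarrow> real) \<Rightarrow> bool" where
  "CN M d \<longleftrightarrow> (\<forall>x\<in>M. \<forall>y\<in>M. \<forall>z\<in>M. \<forall>m. is_midpoint M d y z m \<longrightarrow>
     (d x m)\<^sup>2 \<le> (d x y)\<^sup>2 / 2 + (d x z)\<^sup>2 / 2 - (d y z)\<^sup>2 / 4)"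

lemma CNI:
  assumes "\<And>x y z m. \<lbrakk>x \<in> M; y \<in> M; z \<in> M; is_midpoint M d y z m\<rbrakk> \<Longrightarrow>
     (d x m)\<^sup>2 \<le> (d x y)\<^sup>2 / 2 + (d x z)\<^sup>2 / 2 - (d y z)\<^sup>2 / 4"
  shows "CN M d"
  using assms unfolding CN_def by blast

lemma CND:
  assumes "CN M d" "x \<in> M" "y \<in> M" "z \<in> M" "is_midpoint M d y z m"
  shows "(d x m)\<^sup>2 \<le> (d x y)\<^sup>2 / 2 + (d x z)\<^sup>2 / 2 - (d y z)\<^sup>2 / 4"
  using assms unfolding CN_def by blast

text \<open>Median formula: the bound in \<open>CN\<close> is the squared length of the Euclidean
  comparison median, so \<open>CN\<close> states \<open>CAT0\<close> without a comparison
  triangle.\<close>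

lemma dist_midpoint_sq:
  fixes x y z :: "'a::real_inner"
  shows "(dist x (midpoint y z))\<^sup>2 = (dist x y)\<^sup>2 / 2 + (dist x z)\<^sup>2 / 2 - (dist y z)\<^sup>2 / 4"
  by (simp add: midpoint_def dist_norm power2_norm_eq_inner algebra_simps inner_commute
      add_divide_distrib diff_divide_distrib)

text \<open>\<open>CAT0\<close> quantifies over all comparison triangles, so extracting
  \<open>CN\<close> from it requires that at least one exists. Here y is the origin and z lies on
  the first axis.\<close>

lemma comparison_triangle_exists:
  fixes a b c :: real
  assumes "0 \<le> a" "0 \<le> b" "0 \<le> c" "a \<le> b + c" "b \<le> a + c" "c \<le> a + b"
  shows "\<exists>x y z :: real^2. dist x y = a \<and> dist x z = b \<and> dist y z = c"
proof -
  \<comment> \<open>First coordinate of x by the law of cosines. If c = 0, then a = b, and u = a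
    satisfies the next equation.\<close>
  define u where "u = (if c = 0 then a else (a\<^sup>2 + c\<^sup>2 - b\<^sup>2) / (2 * c))"
  have u: "2 * u * c = a\<^sup>2 + c\<^sup>2 - b\<^sup>2"
    using assms by (auto simp: u_def)
  have "u\<^sup>2 \<le> a\<^sup>2"
  proof (cases "c = 0")
    case False
    have "a\<^sup>2 + c\<^sup>2 - b\<^sup>2 \<le> 2 * a * c"
      using power_mono[of "\<bar>a - c\<bar>" b 2] assms by (simp add: power2_eq_square algebra_simps)
    moreover have "- (2 * a * c) \<le> a\<^sup>2 + c\<^sup>2 - b\<^sup>2"
      using power_mono[of b "a + c" 2] assms by (simp add: power2_eq_square algebra_simps)
    ultimately have "\<bar>u\<bar> \<le> a"
      using False assms(3) u by (auto simp: abs_le_iff u_def field_simps)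
    then show ?thesis using assms(1) power_mono[of "\<bar>u\<bar>" a 2] by simp
  qed (simp add: u_def)
  then have *: "u\<^sup>2 + (sqrt (a\<^sup>2 - u\<^sup>2))\<^sup>2 = a\<^sup>2" by simp
  let ?x = "vector [u, sqrt (a\<^sup>2 - u\<^sup>2)] :: real^2" and ?z = "vector [c, 0] :: real^2"
  have "dist ?x 0 = a"
    using * assms by (simp add: norm_vec_def L2_set_def sum_2)
  moreover have "(u - c)\<^sup>2 + (sqrt (a\<^sup>2 - u\<^sup>2))\<^sup>2 = b\<^sup>2"
    using * u by (simp add: power2_diff)
  then have "dist ?x ?z = b"
    using assms by (simp add: dist_vec_def L2_set_def sum_2 dist_real_def)
  moreover have "dist 0 ?z = c"
    using assms by (simp add: norm_vec_def L2_set_def sum_2)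
  ultimately show ?thesis by blast
qed

lemma (in Metric_space) CAT0_iff_CN: "CAT0 M d \<longleftrightarrow> CN M d"
proof
  assume L: "CAT0 M d"
  show "CN M d"
  proof (rule CNI)
    fix x y z m assume *: "x \<in> M" "y \<in> M" "z \<in> M" and m: "is_midpoint M d y z m"
    obtain x' y' z' :: "real^2" where
      xyz: "dist x' y' = d x y" "dist x' z' = d x z" "dist y' z' = d y z"
      using comparison_triangle_exists[of "d x y" "d x z" "d y z"] *
        triangle[of x z y] triangle[of x y z] triangle[of y x z] commute
      by (metis nonneg add.commute)
    have "d x m \<le> dist x' (midpoint y' z')"
      using L * m xyz unfolding CAT0_def by blast
    then have "(d x m)\<^sup>2 \<le> (dist x' (midpoint y' z'))\<^sup>2" by (simp add: power_mono)
    then show "(d x m)\<^sup>2 \<le> (d x y)\<^sup>2 / 2 + (d x z)\<^sup>2 / 2 - (d y z)\<^sup>2 / 4"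
      by (simp add: dist_midpoint_sq xyz)
  qed
next
  assume R: "CN M d"
  show "CAT0 M d"
    unfolding CAT0_def
  proof (intro ballI allI impI)
    fix x y z m and x' y' z' :: "real^2"
    assume *: "x \<in> M" "y \<in> M" "z \<in> M" "is_midpoint M d y z m"
      and xyz: "dist x' y' = d x y \<and> dist x' z' = d x z \<and> dist y' z' = d y z"
    have "(d x m)\<^sup>2 \<le> (dist x' (midpoint y' z'))\<^sup>2"
      using CND[OF R *] by (simp add: dist_midpoint_sq xyz)
    then show "d x m \<le> dist x' (midpoint y' z')" by (rule power2_le_imp_le) simp
  qed
qed

subsection \<open>Geodesics\<close>

lemma geodesic_mem: "geodesic M d \<gamma> \<Longrightarrow> t \<in> {0..1} \<Longrightarrow> \<gamma> t \<in> M"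
  unfolding geodesic_def by auto

lemma geodesic_dist:
  "geodesic M d \<gamma> \<Longrightarrow> s \<in> {0..1} \<Longrightarrow> t \<in> {0..1} \<Longrightarrow> d (\<gamma> s) (\<gamma> t) = \<bar>s - t\<bar> * d (\<gamma> 0) (\<gamma> 1)"
  unfolding geodesic_def by blast

lemma affine_mem_unit:
  fixes t u v :: real
  assumes "t \<in> {0..1}" "u \<in> {0..1}" "v \<in> {0..1}"
  shows "u + t * (v - u) \<in> {0..1}"
proof -
  have "convex {0..1::real}" by simp
  then have "(1 - t) *\<^sub>R u + t *\<^sub>R v \<in> {0..1}" using assms by (intro convexD_alt) auto
  then show ?thesis by (simp add: algebra_simps)
qed

text \<open>The case u > v is included: it gives reversal and segments running backwards from an
  interior point.\<close>

lemma geodesic_affine: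
  assumes "geodesic M d \<gamma>" "u \<in> {0..1}" "v \<in> {0..1}"
  shows "geodesic M d (\<lambda>t. \<gamma> (u + t * (v - u)))"
  unfolding geodesic_def
proof safe
  fix t :: real assume "t \<in> {0..1}"
  then show "\<gamma> (u + t * (v - u)) \<in> M"
    using affine_mem_unit assms geodesic_mem by blast
next
  fix s t :: real assume st: "s \<in> {0..1}" "t \<in> {0..1}"
  let ?f = "\<lambda>t. u + t * (v - u)"
  have "d (\<gamma> (?f t)) (\<gamma> (?f s)) = \<bar>?f t - ?f s\<bar> * d (\<gamma> 0) (\<gamma> 1)"
    using geodesic_dist[OF assms(1)] affine_mem_unit assms st by blast
  also have "?f t - ?f s = (t - s) * (v - u)" by (simp add: algebra_simps)
  also have "\<bar>(t - s) * (v - u)\<bar> * d (\<gamma> 0) (\<gamma> 1) = \<bar>t - s\<bar> * (\<bar>u - v\<bar> * d (\<gamma> 0) (\<gamma> 1))"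
    by (simp add: abs_mult abs_minus_commute)
  also have "\<bar>u - v\<bar> * d (\<gamma> 0) (\<gamma> 1) = d (\<gamma> u) (\<gamma> v)"
    by (rule geodesic_dist[OF assms, symmetric])
  finally show "d (\<gamma> (?f t)) (\<gamma> (?f s)) = \<bar>t - s\<bar> * d (\<gamma> (u + 0 * (v - u))) (\<gamma> (u + 1 * (v - u)))"
    by simp
qed

lemma geodesic_reverse:
  assumes "geodesic M d \<gamma>"
  shows "geodesic M d (\<lambda>t. \<gamma> (1 - t))"
  using geodesic_affine[OF assms, of 1 0] by simp

lemma geodesic_midpoint:
  assumes "geodesic M d \<gamma>" "u \<in> {0..1}" "v \<in> {0..1}"
  shows "is_midpoint M d (\<gamma> u) (\<gamma> v) (\<gamma> ((u + v) / 2))"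
proof -
  let ?m = "(u + v) / 2"
  have m: "?m \<in> {0..1}" using assms(2,3) by auto
  have "\<bar>u - ?m\<bar> = \<bar>u - v\<bar> / 2" "\<bar>?m - v\<bar> = \<bar>u - v\<bar> / 2"
    by (auto simp: abs_if field_simps)
  then show ?thesis
    unfolding is_midpoint_def geodesic_dist[OF assms(1,2) m] geodesic_dist[OF assms(1) m assms(3)]
      geodesic_dist[OF assms]
    using geodesic_mem[OF assms(1) m] by simp
qed

lemma (in Metric_space) geodesic_const: "x \<in> M \<Longrightarrow> geodesic M d (\<lambda>_. x)"
  unfolding geodesic_def by auto

text \<open>\<open>is_midpoint\<close> mentions no geodesic. Concatenating geodesics from y to m and
  from m to z gives one through m; only distances across m need an argument.\<close>

lemma (in Metric_space) midpoint_on_geodesic: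
  assumes "geodesic_space M d" "y \<in> M" "z \<in> M" "is_midpoint M d y z m"
  obtains \<gamma> where "geodesic M d \<gamma>" "\<gamma> 0 = y" "\<gamma> 1 = z" "\<gamma> (1/2) = m"
proof -
  have m: "m \<in> M" "d y m = d y z / 2" "d m z = d y z / 2"
    using assms(4) unfolding is_midpoint_def by auto
  obtain \<alpha> \<beta> where \<alpha>: "geodesic M d \<alpha>" "\<alpha> 0 = y" "\<alpha> 1 = m"
    and \<beta>: "geodesic M d \<beta>" "\<beta> 0 = m" "\<beta> 1 = z"
    using assms m(1) unfolding geodesic_space_def by meson
  define \<gamma> where "\<gamma> t = (if t \<le> 1/2 then \<alpha> (2 * t) else \<beta> (2 * t - 1))" for t :: real
  define D where "D = d y z"
  have mem: "\<gamma> t \<in> M" if "t \<in> {0..1}" for t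
    using that geodesic_mem[OF \<alpha>(1)] geodesic_mem[OF \<beta>(1)] by (auto simp: \<gamma>_def)
  have low: "d (\<gamma> s) (\<gamma> t) = \<bar>s - t\<bar> * D" if "s \<in> {0..1/2}" "t \<in> {0..1/2}" for s t
  proof -
    have "d (\<gamma> s) (\<gamma> t) = \<bar>2 * s - 2 * t\<bar> * (D / 2)"
      using that geodesic_dist[OF \<alpha>(1), of "2 * s" "2 * t"] \<alpha> m by (simp add: \<gamma>_def D_def)
    also have "\<bar>2 * s - 2 * t\<bar> = 2 * \<bar>s - t\<bar>" by (simp add: abs_if)
    finally show ?thesis by simp
  qed
  have \<gamma>_high: "\<gamma> t = \<beta> (2 * t - 1)" if "t \<in> {1/2..1}" for t
  proof (cases "t \<le> 1/2")
    case True
    then have t: "t = 1/2" using that by simp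
    show ?thesis unfolding t by (simp add: \<gamma>_def \<alpha> \<beta>)
  qed (simp add: \<gamma>_def)
  have high: "d (\<gamma> s) (\<gamma> t) = \<bar>s - t\<bar> * D" if "s \<in> {1/2..1}" "t \<in> {1/2..1}" for s t
  proof -
    have "d (\<gamma> s) (\<gamma> t) = \<bar>(2 * s - 1) - (2 * t - 1)\<bar> * (D / 2)"
      using that geodesic_dist[OF \<beta>(1), of "2 * s - 1" "2 * t - 1"] \<beta> m
      by (simp add: \<gamma>_high D_def)
    also have "\<bar>(2 * s - 1) - (2 * t - 1)\<bar> = 2 * \<bar>s - t\<bar>" by (simp add: abs_if)
    finally show ?thesis by simp
  qed
  have ends: "\<gamma> 0 = y" "\<gamma> 1 = z" "\<gamma> (1/2) = m"
    using \<alpha> \<beta> by (auto simp: \<gamma>_def)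
  have mix: "d (\<gamma> s) (\<gamma> t) = \<bar>s - t\<bar> * D" if "s \<in> {0..1/2}" "t \<in> {1/2..1}" for s t
  proof -
    have "s \<in> {0..1}" "t \<in> {0..1}" using that by auto
    note M = mem[OF this(1)] mem[OF this(2)]
    have "d (\<gamma> s) (\<gamma> t) \<le> d (\<gamma> s) m + d m (\<gamma> t)" using M m triangle by blast
    also have "\<dots> = \<bar>s - 1/2\<bar> * D + \<bar>1/2 - t\<bar> * D"
      using low[of s "1/2"] high[of "1/2" t] that unfolding ends by simp
    also have "\<dots> = (t - s) * D" using that by (simp add: algebra_simps)
    finally have upper: "d (\<gamma> s) (\<gamma> t) \<le> (t - s) * D" .
    \<comment> \<open>If the two points were closer than (t - s) * D, the path from y to z through
      them would be shorter than D.\<close>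
    have "D \<le> d y (\<gamma> s) + d (\<gamma> s) (\<gamma> t) + d (\<gamma> t) z"
      using triangle[of y "\<gamma> s" z] triangle[of "\<gamma> s" "\<gamma> t" z] M assms D_def by linarith
    moreover have "d y (\<gamma> s) = s * D" "d (\<gamma> t) z = (1 - t) * D"
      using low[of 0 s] high[of t 1] that unfolding ends by auto
    ultimately have "d (\<gamma> s) (\<gamma> t) = (t - s) * D"
      using upper unfolding left_diff_distrib by linarith
    then show ?thesis using that by simp
  qed
  have "d (\<gamma> t) (\<gamma> s) = \<bar>t - s\<bar> * d (\<gamma> 0) (\<gamma> 1)" if "s \<in> {0..1}" "t \<in> {0..1}" for s t
  proof -
    consider "t \<le> 1/2" "s \<le> 1/2" | "t \<le> 1/2" "1/2 \<le> s" | "1/2 \<le> t" "s \<le> 1/2" | "1/2 \<le> t" "1/2 \<le> s"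
      by linarith
    then have "d (\<gamma> t) (\<gamma> s) = \<bar>t - s\<bar> * D"
    proof cases
      case 3
      then show ?thesis
        using mix[of s t] that unfolding commute[of "\<gamma> t"] abs_minus_commute[of t] by simp
    qed (use that in \<open>simp_all add: low mix high\<close>)
    then show ?thesis by (simp add: ends D_def)
  qed
  moreover have "\<gamma> ` {0..1} \<subseteq> M" using mem by blast
  ultimately have "geodesic M d \<gamma>" unfolding geodesic_def by blast
  then show thesis using that ends by blast
qed

subsection \<open>The product with the real line\<close>

lemma l2_prod_dist_nonneg: "0 \<le> l2_prod_dist d p q"
  by (simp add: l2_prod_dist_def)

lemma l2_prod_dist_sq: "(l2_prod_dist d p q)\<^sup>2 = (d (fst p) (fst q))\<^sup>2 + (snd p - snd q)\<^sup>2"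
  by (simp add: l2_prod_dist_def)

context Metric_space
begin

lemma Metric_space_l2_prod: "Metric_space (M \<times> (UNIV :: real set)) (l2_prod_dist d)"
proof
  fix p q r :: "'a \<times> real"
  show "0 \<le> l2_prod_dist d p q" by (rule l2_prod_dist_nonneg)
  show "l2_prod_dist d p q = l2_prod_dist d q p"
    by (simp add: l2_prod_dist_def commute power2_commute)
  assume p: "p \<in> M \<times> UNIV" and q: "q \<in> M \<times> UNIV"
  then show "(l2_prod_dist d p q = 0) = (p = q)"
    by (auto simp: l2_prod_dist_def sum_power2_eq_zero_iff)
  assume r: "r \<in> M \<times> UNIV"
  have "l2_prod_dist d p r \<le>
      sqrt ((d (fst p) (fst q) + d (fst q) (fst r))\<^sup>2 + ((snd p - snd q) + (snd q - snd r))\<^sup>2)"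
    unfolding l2_prod_dist_def using p q r
    by (intro real_sqrt_le_mono add_mono) (auto intro!: power_mono triangle)
  also have "\<dots> \<le> l2_prod_dist d p q + l2_prod_dist d q r"
    unfolding l2_prod_dist_def by (rule real_sqrt_sum_squares_triangle_ineq)
  finally show "l2_prod_dist d p r \<le> l2_prod_dist d p q + l2_prod_dist d q r" .
qed

text \<open>The free slope \<open>b\<close> is what allows geodesics of \<open>M\<close> to be
  tilted. Both components scale by the same factor, hence so does the product distance.\<close>

lemma geodesic_l2_prod:
  assumes "geodesic M d \<gamma>"
  shows "geodesic (M \<times> UNIV) (l2_prod_dist d) (\<lambda>t. (\<gamma> t, a + b * t))"
  unfolding geodesic_def
proof safe
  fix s t :: real assume st: "s \<in> {0..1}" "t \<in> {0..1}"
  have "l2_prod_dist d (\<gamma> t, a + b * t) (\<gamma> s, a + b * s)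
     = sqrt ((\<bar>t - s\<bar> * d (\<gamma> 0) (\<gamma> 1))\<^sup>2 + ((t - s) * b)\<^sup>2)"
    using geodesic_dist[OF assms st(2,1)]
    by (simp add: l2_prod_dist_def left_diff_distrib mult.commute[of b])
  also have "\<dots> = sqrt ((t - s)\<^sup>2 * ((d (\<gamma> 0) (\<gamma> 1))\<^sup>2 + b\<^sup>2))"
    by (simp add: power_mult_distrib distrib_left)
  also have "\<dots> = \<bar>t - s\<bar> * l2_prod_dist d (\<gamma> 0, a + b * 0) (\<gamma> 1, a + b * 1)"
    by (simp add: l2_prod_dist_def real_sqrt_mult)
  finally show "l2_prod_dist d (\<gamma> t, a + b * t) (\<gamma> s, a + b * s) =
    \<bar>t - s\<bar> * l2_prod_dist d (\<gamma> 0, a + b * 0) (\<gamma> 1, a + b * 1)" .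
qed (use geodesic_mem[OF assms] in auto)

lemma geodesic_space_l2_prod:
  assumes "geodesic_space M d"
  shows "geodesic_space (M \<times> (UNIV :: real set)) (l2_prod_dist d)"
  unfolding geodesic_space_def
proof (intro conjI ballI)
  fix p q :: "'a \<times> real" assume "p \<in> M \<times> UNIV" "q \<in> M \<times> UNIV"
  then obtain \<gamma> where \<gamma>: "geodesic M d \<gamma>" "\<gamma> 0 = fst p" "\<gamma> 1 = fst q"
    using assms unfolding geodesic_space_def by fastforce
  show "\<exists>\<gamma>. geodesic (M \<times> UNIV) (l2_prod_dist d) \<gamma> \<and> \<gamma> 0 = p \<and> \<gamma> 1 = q"
    using geodesic_l2_prod[OF \<gamma>(1), of "snd p" "snd q - snd p"] \<gamma>(2,3)
    by (intro exI[of _ "\<lambda>t. (\<gamma> t, snd p + (snd q - snd p) * t)"]) auto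
qed (rule Metric_space_l2_prod)

text \<open>Equality in Minkowski's inequality for the two halves forces equal increments.\<close>
lemma is_midpoint_l2_prod:
  assumes "y \<in> M \<times> UNIV" "z \<in> M \<times> UNIV"
    and "is_midpoint (M \<times> UNIV) (l2_prod_dist d) y z m"
  shows "is_midpoint M d (fst y) (fst z) (fst m)" "snd m = (snd y + snd z) / 2"
proof -
  define a a' D where "a = d (fst y) (fst m)" and "a' = d (fst m) (fst z)" and "D = d (fst y) (fst z)"
  define b b' where "b = snd m - snd y" and "b' = snd z - snd m"
  have m: "m \<in> M \<times> UNIV" "l2_prod_dist d y m = l2_prod_dist d y z / 2"
      "l2_prod_dist d m z = l2_prod_dist d y z / 2"
    using assms(3) unfolding is_midpoint_def by auto
  have "(l2_prod_dist d y m)\<^sup>2 = (l2_prod_dist d y z)\<^sup>2 / 4"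
    "(l2_prod_dist d m z)\<^sup>2 = (l2_prod_dist d y z)\<^sup>2 / 4"
    by (simp_all add: m(2,3) power_divide)
  moreover have "(snd y - snd m)\<^sup>2 = b\<^sup>2" "(snd m - snd z)\<^sup>2 = b'\<^sup>2" "(snd y - snd z)\<^sup>2 = (b + b')\<^sup>2"
    by (auto simp: b_def b'_def power2_commute)
  ultimately have e: "4 * (a\<^sup>2 + b\<^sup>2) = D\<^sup>2 + (b + b')\<^sup>2" "4 * (a'\<^sup>2 + b'\<^sup>2) = D\<^sup>2 + (b + b')\<^sup>2"
    by (simp_all add: l2_prod_dist_sq a_def a'_def D_def)
  have "0 \<le> D" "D \<le> a + a'"
    using assms(1,2) m(1) by (auto simp: D_def a_def a'_def intro!: triangle)
  then have D: "D\<^sup>2 \<le> (a + a')\<^sup>2" by (simp add: power_mono)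
  \<comment> \<open>Half the sum of the two equations \<open>e\<close>, with the parallelogram law.
    All three summands are non-negative, so each vanishes.\<close>
  have "(a - a')\<^sup>2 + (b - b')\<^sup>2 + ((a + a')\<^sup>2 - D\<^sup>2) = 0"
    using e by (simp add: power2_eq_square algebra_simps)
  moreover have "0 \<le> (a - a')\<^sup>2" "0 \<le> (b - b')\<^sup>2" by auto
  ultimately have "(a - a')\<^sup>2 = 0" "(b - b')\<^sup>2 = 0" "(a + a')\<^sup>2 = D\<^sup>2"
    using D by linarith+
  moreover have "0 \<le> a + a'" by (simp add: a_def a'_def)
  ultimately have "a = a'" "b = b'" "a + a' = D"
    using \<open>0 \<le> D\<close> power2_eq_imp_eq[of "a + a'" D] by simp_all
  then show "is_midpoint M d (fst y) (fst z) (fst m)" "snd m = (snd y + snd z) / 2"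
    using m(1) by (auto simp: is_midpoint_def a_def a'_def b_def b'_def D_def field_simps)
qed

text \<open>Squared distances add, midpoints of the product have midpoints as components, and on the
  line \<open>CN\<close> is an equality.\<close>

lemma CN_l2_prod:
  assumes "CN M d"
  shows "CN (M \<times> (UNIV :: real set)) (l2_prod_dist d)"
proof (rule CNI)
  fix x y z m :: "'a \<times> real"
  assume *: "x \<in> M \<times> UNIV" "y \<in> M \<times> UNIV" "z \<in> M \<times> UNIV"
    and m: "is_midpoint (M \<times> UNIV) (l2_prod_dist d) y z m"
  have "(d (fst x) (fst m))\<^sup>2 \<le> (d (fst x) (fst y))\<^sup>2 / 2 + (d (fst x) (fst z))\<^sup>2 / 2 - (d (fst y) (fst z))\<^sup>2 / 4"
    using CND[OF assms _ _ _ is_midpoint_l2_prod(1)[OF *(2,3) m]] * by auto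
  moreover have "(snd x - snd m)\<^sup>2 = (snd x - snd y)\<^sup>2 / 2 + (snd x - snd z)\<^sup>2 / 2 - (snd y - snd z)\<^sup>2 / 4"
    unfolding is_midpoint_l2_prod(2)[OF *(2,3) m] by (simp add: power2_eq_square field_simps)
  ultimately show "(l2_prod_dist d x m)\<^sup>2 \<le> (l2_prod_dist d x y)\<^sup>2 / 2
      + (l2_prod_dist d x z)\<^sup>2 / 2 - (l2_prod_dist d y z)\<^sup>2 / 4"
    unfolding l2_prod_dist_sq by (simp add: add_divide_distrib)
qed

subsection \<open>Consequences of the CN inequality\<close>

lemma CN_imp_busemann:
  assumes "CN M d"
  shows "busemann_convex M d"
  unfolding busemann_convex_def
proof (intro allI impI, elim conjE)
  fix \<gamma> \<eta> assume g: "geodesic M d \<gamma>" "geodesic M d \<eta>" "\<gamma> 0 = \<eta> 0"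
  have M: "\<gamma> 0 \<in> M" "\<gamma> 1 \<in> M" "\<gamma> (1/2) \<in> M" "\<eta> 1 \<in> M"
    using geodesic_mem[OF g(1)] geodesic_mem[OF g(2)] by auto
  have m: "is_midpoint M d (\<gamma> 0) (\<gamma> 1) (\<gamma> (1/2))" "is_midpoint M d (\<gamma> 0) (\<eta> 1) (\<eta> (1/2))"
    using geodesic_midpoint[OF g(1), of 0 1] geodesic_midpoint[OF g(2), of 0 1] g(3) by auto
  have "d (\<gamma> (1/2)) (\<gamma> 0) = d (\<gamma> 0) (\<gamma> 1) / 2"
    using m(1) commute[of "\<gamma> (1/2)" "\<gamma> 0"] unfolding is_midpoint_def by linarith
  then have "(d (\<gamma> (1/2)) (\<gamma> 0))\<^sup>2 = (d (\<gamma> 0) (\<gamma> 1))\<^sup>2 / 4"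
    by (simp only: power_divide) simp
  \<comment> \<open>\<open>CN\<close> is applied to the median from \<gamma>(1/2) to the segment
    from \<gamma>(0) to \<eta>(1), then to the median from \<eta>(1) to \<gamma>. All terms at the
    common origin cancel.\<close>
  then have "(d (\<gamma> (1/2)) (\<eta> (1/2)))\<^sup>2 \<le> (d (\<gamma> 1) (\<eta> 1))\<^sup>2 / 4"
    using CND[OF assms M(3,1,4) m(2)] CND[OF assms M(4,1,2) m(1)]
    by (simp add: commute)
  then have "(d (\<gamma> (1/2)) (\<eta> (1/2)))\<^sup>2 \<le> (d (\<gamma> 1) (\<eta> 1) / 2)\<^sup>2" by (simp add: power_divide)
  then show "d (\<gamma> (1/2)) (\<eta> (1/2)) \<le> d (\<gamma> 1) (\<eta> 1) / 2" by (rule power2_le_imp_le) simp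
qed

text \<open>Let g be the excess of the squared distance over its Euclidean value at a right angle.
  \<open>CN\<close> gives g(t/2) <= g(t)/2, hence g(1/2^n) <= g(1)/2^n, while nearness bounds
  g(1/2^n) below by a quadratic term. Dividing by 1/2^n and letting n grow gives 0 <= g(1).\<close>

lemma CN_nearest_pythagoras:
  assumes "CN M d" "geodesic M d \<gamma>" "x \<in> M"
    and nearest: "\<And>t. t \<in> {0..1} \<Longrightarrow> d x (\<gamma> 0) \<le> d x (\<gamma> t)"
  shows "(d x (\<gamma> 0))\<^sup>2 + (d (\<gamma> 0) (\<gamma> 1))\<^sup>2 \<le> (d x (\<gamma> 1))\<^sup>2"
proof -
  define D where "D = d (\<gamma> 0) (\<gamma> 1)"
  define g where "g t = (d x (\<gamma> t))\<^sup>2 - (d x (\<gamma> 0))\<^sup>2 - (t * D)\<^sup>2" for t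
  have half: "g (t / 2) \<le> g t / 2" if t: "t \<in> {0..1}" for t
  proof -
    have "(d x (\<gamma> (t / 2)))\<^sup>2 \<le> (d x (\<gamma> 0))\<^sup>2 / 2 + (d x (\<gamma> t))\<^sup>2 / 2 - (d (\<gamma> 0) (\<gamma> t))\<^sup>2 / 4"
      using CND[OF assms(1,3) _ _ geodesic_midpoint[OF assms(2), of 0 t]] t
        geodesic_mem[OF assms(2)] by simp
    moreover have "d (\<gamma> 0) (\<gamma> t) = t * D"
      using geodesic_dist[OF assms(2), of 0 t] t D_def by simp
    ultimately show ?thesis by (simp add: g_def power_divide power_mult_distrib field_simps)
  qed
  have "g ((1/2) ^ n) \<le> (1/2) ^ n * g 1" for n
  proof (induction n)
    case (Suc n)
    have "g ((1/2) ^ Suc n) \<le> g ((1/2) ^ n) / 2"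
      using half[of "(1/2) ^ n"] by (simp add: power_le_one)
    then show ?case using Suc by simp
  qed simp
  moreover have "- ((1/2) ^ n * D)\<^sup>2 \<le> g ((1/2) ^ n)" for n
    using power_mono[OF nearest[of "(1/2) ^ n"], of 2] by (simp add: g_def power_le_one)
  ultimately have "- ((1/2) ^ n * D)\<^sup>2 \<le> (1/2) ^ n * g 1" for n
    using order_trans by blast
  then have "(1/2) ^ n * (- ((1/2) ^ n * D\<^sup>2)) \<le> (1/2) ^ n * g 1" for n
    by (simp add: power2_eq_square mult.assoc mult.left_commute)
  then have "- ((1/2) ^ n * D\<^sup>2) \<le> g 1" for n
    by (rule mult_left_le_imp_le) simp
  moreover have "(\<lambda>n. - ((1/2) ^ n * D\<^sup>2)) \<longlonglongrightarrow> - (0 * D\<^sup>2)"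
    by (intro tendsto_intros LIMSEQ_power_zero) simp
  ultimately have "- (0 * D\<^sup>2) \<le> g 1" by (intro LIMSEQ_le_const2) auto
  then show ?thesis by (simp add: g_def D_def)
qed

text \<open>Orthogonality makes p the point of \<eta> nearest to each point of \<gamma>. Pythagoras
  on the part of \<eta> up to time t, with the leg along \<gamma> dropped, is the reversed
  relation.\<close>

lemma CN_imp_SO:
  assumes "CN M d"
  shows "SO_prop M d"
  unfolding SO_prop_def
proof (intro allI impI, elim conjE)
  fix p \<gamma> \<eta> assume g: "geodesic M d \<gamma>" "geodesic M d \<eta>" "\<gamma> 0 = p" "\<eta> 0 = p" and o: "orth d p \<gamma> \<eta>"
  show "orth d p \<eta> \<gamma>"
    unfolding orth_def
  proof (intro ballI)
    fix s t :: real assume st: "s \<in> {0..1}" "t \<in> {0..1}"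
    note M = geodesic_mem[OF g(1) st(1)] geodesic_mem[OF g(2) st(2)]
    have "geodesic M d (\<lambda>u. \<eta> (0 + u * (t - 0)))"
      using geodesic_affine[OF g(2), of 0 t] st by simp
    moreover have "d (\<gamma> s) (\<eta> 0) \<le> d (\<gamma> s) (\<eta> (0 + u * (t - 0)))" if "u \<in> {0..1}" for u
      using o st affine_mem_unit[OF that, of 0 t] commute[of "\<gamma> s"]
      unfolding orth_def g by auto
    ultimately have "(d (\<gamma> s) (\<eta> 0))\<^sup>2 + (d (\<eta> 0) (\<eta> t))\<^sup>2 \<le> (d (\<gamma> s) (\<eta> t))\<^sup>2"
      using CN_nearest_pythagoras[OF assms, of "\<lambda>u. \<eta> (0 + u * (t - 0))" "\<gamma> s"] M
      by simp
    then have "(d p (\<eta> t))\<^sup>2 \<le> (d (\<gamma> s) (\<eta> t))\<^sup>2"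
      using zero_le_power2[of "d (\<gamma> s) p"] unfolding g by linarith
    then show "d p (\<eta> t) \<le> d (\<gamma> s) (\<eta> t)" by (rule power2_le_imp_le) simp
  qed
qed

text \<open>Diagonals against sides of the quadrilateral x, p, q, y. \<open>CN\<close> bounds the
  distances from y and p to the midpoint of the diagonal from x to q, and (a + b)^2 <= 2a^2 + 2b^2
  joins them into the other diagonal.\<close>

lemma CN_four_point:
  assumes "CN M d" "geodesic_space M d" "x \<in> M" "y \<in> M" "p \<in> M" "q \<in> M"
  shows "(d x q)\<^sup>2 + (d y p)\<^sup>2 \<le> (d x p)\<^sup>2 + (d p q)\<^sup>2 + (d q y)\<^sup>2 + (d x y)\<^sup>2"
proof -
  obtain \<gamma> where \<gamma>: "geodesic M d \<gamma>" "\<gamma> 0 = x" "\<gamma> 1 = q"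
    using assms unfolding geodesic_space_def by meson
  define m where "m = \<gamma> (1/2)"
  have m: "is_midpoint M d x q m" "m \<in> M"
    using geodesic_midpoint[OF \<gamma>(1), of 0 1] geodesic_mem[OF \<gamma>(1), of "1/2"] \<gamma> by (auto simp: m_def)
  have "d y p \<le> d y m + d p m"
    using triangle assms m(2) commute by metis
  then have "(d y p)\<^sup>2 \<le> (d y m + d p m)\<^sup>2" by (simp add: power_mono)
  moreover have "0 \<le> (d y m - d p m)\<^sup>2" by simp
  ultimately have "(d y p)\<^sup>2 \<le> 2 * (d y m)\<^sup>2 + 2 * (d p m)\<^sup>2"
    unfolding power2_sum power2_diff by linarith
  then show ?thesis
    using CND[OF assms(1,4,3,6) m(1)] CND[OF assms(1,5,3,6) m(1)]
    by (simp add: commute)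
qed

lemma CN_imp_NE:
  assumes "CN M d" "geodesic_space M d"
  shows "NE_prop M d"
  unfolding NE_prop_def
proof (intro allI impI ballI, elim conjE)
  fix C x y p q
  assume C: "weakly_convex M d C" and xy: "x \<in> M" "y \<in> M"
    and pq: "p \<in> nearest_points d C x" "q \<in> nearest_points d C y"
  have M: "p \<in> C" "q \<in> C" "p \<in> M" "q \<in> M"
    using C pq unfolding weakly_convex_def nearest_points_def by auto
  have pyth: "(d x p)\<^sup>2 + (d p q)\<^sup>2 \<le> (d x q)\<^sup>2"
    if "x \<in> M" "p \<in> nearest_points d C x" "q \<in> C" for x p q
  proof -
    have "p \<in> C" using that unfolding nearest_points_def by simp
    then obtain \<gamma> where \<gamma>: "geodesic M d \<gamma>" "\<gamma> 0 = p" "\<gamma> 1 = q" "\<gamma> ` {0..1} \<subseteq> C"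
      using C \<open>q \<in> C\<close> unfolding weakly_convex_def by meson
    have "d x (\<gamma> 0) \<le> d x (\<gamma> t)" if "t \<in> {0..1}" for t
    proof -
      have "\<gamma> t \<in> C" using \<gamma>(4) that by blast
      then show ?thesis using \<open>p \<in> nearest_points d C x\<close> \<gamma>(2) unfolding nearest_points_def by simp
    qed
    then show ?thesis using CN_nearest_pythagoras[OF assms(1) \<gamma>(1) that(1)] \<gamma> by simp
  qed
  \<comment> \<open>Adding Pythagoras at both feet bounds the diagonals from below; comparison with
    the four-point inequality leaves only these two sides.\<close>
  have "(d p q)\<^sup>2 \<le> (d x y)\<^sup>2"
    using pyth[OF xy(1) pq(1) M(2)] pyth[OF xy(2) pq(2) M(1)] CN_four_point[OF assms xy M(3,4)]
    unfolding commute[of y q] commute[of q p] by linarith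
  then show "d p q \<le> d x y" by (rule power2_le_imp_le) simp
qed

subsection \<open>Non-expansive projections force symmetric orthogonality\<close>

lemma closedin_geodesic_image:
  assumes "geodesic M d \<gamma>"
  shows "closedin mtopology (\<gamma> ` {0..1})"
proof -
  have "continuous_map (top_of_set {0..1}) mtopology \<gamma>"
    unfolding continuous_map_to_metric
  proof (intro ballI allI impI)
    fix s \<epsilon> :: real assume s: "s \<in> topspace (top_of_set {0..1})" and "0 < \<epsilon>"
    \<comment> \<open>The summand 1 keeps the Lipschitz constant positive for a constant
      geodesic.\<close>
    define D where "D = d (\<gamma> 0) (\<gamma> 1) + 1"
    have D: "0 < D" by (simp add: D_def add_nonneg_pos)
    have "d (\<gamma> s) (\<gamma> t) < \<epsilon>" if "t \<in> {0..1}" "dist s t < \<epsilon> / D" for t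
    proof -
      have "d (\<gamma> s) (\<gamma> t) = \<bar>s - t\<bar> * d (\<gamma> 0) (\<gamma> 1)"
        using s that by (intro geodesic_dist[OF assms]) auto
      also have "\<dots> \<le> \<bar>s - t\<bar> * D" by (intro mult_left_mono) (auto simp: D_def)
      also have "\<dots> < \<epsilon>" using that D by (simp add: dist_real_def field_simps)
      finally show ?thesis .
    qed
    then have "\<forall>t\<in>{0..1} \<inter> ball s (\<epsilon> / D). \<gamma> t \<in> mball (\<gamma> s) \<epsilon>"
      using s geodesic_mem[OF assms] by (simp add: in_mball)
    moreover have "s \<in> {0..1} \<inter> ball s (\<epsilon> / D)" using s \<open>0 < \<epsilon>\<close> D by simp
    moreover have "openin (top_of_set {0..1}) ({0..1} \<inter> ball s (\<epsilon> / D))"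
      by (rule openin_open_Int) simp
    ultimately show "\<exists>U. openin (top_of_set {0..1}) U \<and> s \<in> U \<and> (\<forall>t\<in>U. \<gamma> t \<in> mball (\<gamma> s) \<epsilon>)"
      by blast
  qed
  then have "compactin mtopology (\<gamma> ` {0..1})"
    by (intro image_compactin[of "top_of_set {0..1}"]) (simp_all add: compactin_subtopology)
  then show ?thesis by (rule compactin_imp_closedin[OF Hausdorff_space_mtopology])
qed

lemma weakly_convex_geodesic_image:
  assumes "geodesic M d \<gamma>"
  shows "weakly_convex M d (\<gamma> ` {0..1})"
  unfolding weakly_convex_def
proof (intro conjI ballI)
  show "\<gamma> ` {0..1} \<subseteq> M" using geodesic_mem[OF assms] by auto
  fix x y assume "x \<in> \<gamma> ` {0..1}" "y \<in> \<gamma> ` {0..1}"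
  then obtain u v where uv: "u \<in> {0..1}" "v \<in> {0..1}" "x = \<gamma> u" "y = \<gamma> v" by auto
  let ?\<eta> = "\<lambda>t. \<gamma> (u + t * (v - u))"
  have "?\<eta> ` {0..1} \<subseteq> \<gamma> ` {0..1}" using affine_mem_unit[OF _ uv(1,2)] by blast
  moreover have "?\<eta> 0 = x" "?\<eta> 1 = y" using uv by simp_all
  ultimately show "\<exists>\<eta>. geodesic M d \<eta> \<and> \<eta> 0 = x \<and> \<eta> 1 = y \<and> \<eta> ` {0..1} \<subseteq> \<gamma> ` {0..1}"
    using geodesic_affine[OF assms uv(1,2)] by blast
qed

text \<open>Project onto the image of \<eta>: by orthogonality p is a nearest point of \<gamma>(s),
  while \<eta>(t) is its own nearest point.\<close>

lemma NE_imp_SO: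
  assumes "NE_prop M d"
  shows "SO_prop M d"
  unfolding SO_prop_def
proof (intro allI impI, elim conjE)
  fix p \<gamma> \<eta> assume g: "geodesic M d \<gamma>" "geodesic M d \<eta>" "\<gamma> 0 = p" "\<eta> 0 = p" and o: "orth d p \<gamma> \<eta>"
  let ?C = "\<eta> ` {0..1}"
  show "orth d p \<eta> \<gamma>"
    unfolding orth_def
  proof (intro ballI)
    fix s t :: real assume st: "s \<in> {0..1}" "t \<in> {0..1}"
    note M = geodesic_mem[OF g(1) st(1)] geodesic_mem[OF g(2) st(2)]
    have "p \<in> nearest_points d ?C (\<gamma> s)"
      using o st g(4) unfolding nearest_points_def orth_def by (force simp: commute)
    moreover have "\<eta> t \<in> nearest_points d ?C (\<eta> t)"
      using st M unfolding nearest_points_def by simp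
    ultimately show "d p (\<eta> t) \<le> d (\<gamma> s) (\<eta> t)"
      using assms closedin_geodesic_image[OF g(2)] weakly_convex_geodesic_image[OF g(2)] M
      unfolding NE_prop_def by blast
  qed
qed

end


subsection \<open>Busemann convex spaces\<close>

text \<open>A maximum point r is the midpoint of an end of the interval and another point of it, so
  h(r) <= h(r)/2.\<close>

lemma midpoint_subconvex_nonpos:
  fixes h :: "real \<Rightarrow> real"
  assumes cont: "continuous_on {0..1} h"
    and ends: "h 0 \<le> 0" "h 1 \<le> 0"
    and mid: "\<And>u v. u \<in> {0..1} \<Longrightarrow> v \<in> {0..1} \<Longrightarrow> h ((u + v) / 2) \<le> (h u + h v) / 2"
    and t: "t \<in> {0..1}"
  shows "h t \<le> 0"
proof -
  obtain r where r: "r \<in> {0..1}" "\<And>t. t \<in> {0..1} \<Longrightarrow> h t \<le> h r"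
    using continuous_attains_sup[OF _ _ cont] by auto
  have "h r \<le> 0"
  proof (cases "r \<le> 1/2")
    case True
    then show ?thesis using mid[of 0 "2 * r"] r(2)[of "2 * r"] r(1) ends by simp
  next
    case False
    then show ?thesis using mid[of "2 * r - 1" 1] r(2)[of "2 * r - 1"] r(1) ends by simp
  qed
  then show ?thesis using r(2)[OF t] by simp
qed

locale busemann_space = Metric_space +
  assumes geodesic_space: "geodesic_space M d"
    and busemann_convex: "busemann_convex M d"
begin

lemma geodesic_between:
  assumes "x \<in> M" "y \<in> M"
  obtains \<gamma> where "geodesic M d \<gamma>" "\<gamma> 0 = x" "\<gamma> 1 = y"
  using geodesic_space assms unfolding geodesic_space_def by meson

text \<open>A diagonal \<omega> cuts the quadrilateral into two triangles. The second has its common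
  vertex at parameter 1, so its geodesics are reversed before Busemann convexity applies.\<close>

lemma dist_midpoints_le:
  assumes "geodesic M d \<xi>" "geodesic M d \<zeta>"
  shows "d (\<xi> (1/2)) (\<zeta> (1/2)) \<le> (d (\<xi> 0) (\<zeta> 0) + d (\<xi> 1) (\<zeta> 1)) / 2"
proof -
  have half: "d (\<gamma> (1/2)) (\<eta> (1/2)) \<le> d (\<gamma> 1) (\<eta> 1) / 2"
    if "geodesic M d \<gamma>" "geodesic M d \<eta>" "\<gamma> 0 = \<eta> 0" for \<gamma> \<eta>
    using busemann_convex that unfolding busemann_convex_def by blast
  obtain \<omega> where \<omega>: "geodesic M d \<omega>" "\<omega> 0 = \<xi> 0" "\<omega> 1 = \<zeta> 1"
    using geodesic_between geodesic_mem[OF assms(1), of 0] geodesic_mem[OF assms(2), of 1] by auto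
  have "d (\<xi> (1/2)) (\<omega> (1/2)) \<le> d (\<xi> 1) (\<zeta> 1) / 2"
    using half[OF assms(1) \<omega>(1)] \<omega> by simp
  moreover have "d (\<omega> (1/2)) (\<zeta> (1/2)) \<le> d (\<xi> 0) (\<zeta> 0) / 2"
    using half[OF geodesic_reverse[OF \<omega>(1)] geodesic_reverse[OF assms(2)]] \<omega> by simp
  moreover have "d (\<xi> (1/2)) (\<zeta> (1/2)) \<le> d (\<xi> (1/2)) (\<omega> (1/2)) + d (\<omega> (1/2)) (\<zeta> (1/2))"
    using geodesic_mem[OF assms(1)] geodesic_mem[OF assms(2)] geodesic_mem[OF \<omega>(1)]
    by (intro triangle) auto
  ultimately show ?thesis by (simp add: add_divide_distrib)
qed

lemma dist_geodesics_convex: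
  assumes \<xi>: "geodesic M d \<xi>" and \<zeta>: "geodesic M d \<zeta>" and t: "t \<in> {0..1}"
  shows "d (\<xi> t) (\<zeta> t) \<le> (1 - t) * d (\<xi> 0) (\<zeta> 0) + t * d (\<xi> 1) (\<zeta> 1)"
proof -
  \<comment> \<open>Subtracting the chord makes h vanish at both ends; continuity then upgrades
    midpoint convexity to all parameters.\<close>
  define h where "h t = d (\<xi> t) (\<zeta> t) - ((1 - t) * d (\<xi> 0) (\<zeta> 0) + t * d (\<xi> 1) (\<zeta> 1))" for t
  define K where "K = d (\<xi> 0) (\<xi> 1) + d (\<zeta> 0) (\<zeta> 1)"
  have lip: "dist (d (\<xi> s) (\<zeta> s)) (d (\<xi> t) (\<zeta> t)) \<le> K * dist s t"
    if st: "s \<in> {0..1}" "t \<in> {0..1}" for s t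
  proof -
    note M = geodesic_mem[OF \<xi> st(1)] geodesic_mem[OF \<xi> st(2)]
      geodesic_mem[OF \<zeta> st(1)] geodesic_mem[OF \<zeta> st(2)]
    have "\<bar>d (\<xi> s) (\<zeta> s) - d (\<xi> t) (\<zeta> t)\<bar> \<le> d (\<xi> s) (\<xi> t) + d (\<zeta> s) (\<zeta> t)"
      using triangle[OF M(1,2,3)] triangle[OF M(2,4,3)] triangle[OF M(2,1,4)] triangle[OF M(1,3,4)]
        commute[of "\<xi> t" "\<xi> s"] commute[of "\<zeta> t" "\<zeta> s"] by linarith
    also have "\<dots> = K * dist s t"
      unfolding geodesic_dist[OF \<xi> st] geodesic_dist[OF \<zeta> st]
      by (simp add: K_def dist_real_def algebra_simps)
    finally show ?thesis by (simp add: dist_real_def)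
  qed
  have "K-lipschitz_on {0..1} (\<lambda>t. d (\<xi> t) (\<zeta> t))"
    using lip by (intro lipschitz_onI) (auto simp: K_def)
  then have "continuous_on {0..1} h"
    unfolding h_def by (intro continuous_intros lipschitz_on_continuous_on)
  moreover have "h ((u + v) / 2) \<le> (h u + h v) / 2" if uv: "u \<in> {0..1}" "v \<in> {0..1}" for u v
  proof -
    have mid: "u + (1/2) * (v - u) = (u + v) / 2" by (simp add: field_simps)
    have "d (\<xi> ((u + v) / 2)) (\<zeta> ((u + v) / 2)) \<le> (d (\<xi> u) (\<zeta> u) + d (\<xi> v) (\<zeta> v)) / 2"
      using dist_midpoints_le[OF geodesic_affine[OF \<xi> uv] geodesic_affine[OF \<zeta> uv]]
      unfolding mid by simp
    then show ?thesis by (simp add: h_def field_simps)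
  qed
  moreover have "h 0 \<le> 0" "h 1 \<le> 0" by (simp_all add: h_def)
  ultimately have "h t \<le> 0" using midpoint_subconvex_nonpos[of h t] t by blast
  then show ?thesis by (simp add: h_def)
qed

lemma dist_to_point_convex:
  assumes "geodesic M d \<xi>" "x \<in> M" "t \<in> {0..1}"
  shows "d x (\<xi> t) \<le> (1 - t) * d x (\<xi> 0) + t * d x (\<xi> 1)"
  using dist_geodesics_convex[OF geodesic_const[OF assms(2)] assms(1,3)] by simp

text \<open>Provides the supporting line at the midpoint of a geodesic from which the final estimate
  starts.\<close>

lemma dist_sq_to_point_convex:
  assumes "geodesic M d \<gamma>" "x \<in> M"
  shows "convex_on {0..1} (\<lambda>t. (d x (\<gamma> t))\<^sup>2)"
proof (intro convex_onI)
  fix t u v :: real assume t: "0 < t" "t < 1" and uv: "u \<in> {0..1}" "v \<in> {0..1}"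
  let ?a = "d x (\<gamma> u)" and ?b = "d x (\<gamma> v)"
  have e: "u + t * (v - u) = (1 - t) * u + t * v" by (simp add: algebra_simps)
  have "d x (\<gamma> (u + t * (v - u))) \<le> (1 - t) * ?a + t * ?b"
    using dist_to_point_convex[OF geodesic_affine[OF assms(1) uv] assms(2), of t] t by simp
  then have "(d x (\<gamma> (u + t * (v - u))))\<^sup>2 \<le> ((1 - t) * ?a + t * ?b)\<^sup>2"
    by (simp add: power_mono)
  also have "\<dots> = (1 - t) * ?a\<^sup>2 + t * ?b\<^sup>2 - t * (1 - t) * (?a - ?b)\<^sup>2"
    by (simp add: power2_eq_square algebra_simps)
  also have "\<dots> \<le> (1 - t) * ?a\<^sup>2 + t * ?b\<^sup>2" using t by simp
  finally show "(d x (\<gamma> ((1 - t) *\<^sub>R u + t *\<^sub>R v)))\<^sup>2 \<le> (1 - t) * ?a\<^sup>2 + t * ?b\<^sup>2"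
    by (simp add: e)
qed simp

section \<open>From stable symmetric orthogonality to CN\<close>

lemma dist_from_geodesic_linear_bound:
  assumes \<xi>: "geodesic M d \<xi>" and q: "q \<in> M" and pos: "0 < d q (\<xi> 0)"
    and lower: "\<And>r. r \<in> {0..1} \<Longrightarrow> (d q (\<xi> 0))\<^sup>2 + 2 * c * r \<le> (d q (\<xi> r))\<^sup>2"
    and r: "r \<in> {0..1}"
  shows "d q (\<xi> 0) + c / d q (\<xi> 0) * r \<le> d q (\<xi> r)"
proof -
  define L where "L = d q (\<xi> 0)"
  define e where "e = d q (\<xi> r) - L"
  \<comment> \<open>Convexity of the distance compares the points at l * r and r. After division by
    l, the limit l to 0 removes the quadratic term and turns the bound on the square into one on the
    distance itself.\<close>
  have "2 * c * r \<le> 2 * L * e + l * e\<^sup>2" if l: "0 < l" "l < 1" for l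
  proof -
    have lr: "l * r \<in> {0..1}" using l r by (auto simp: mult_le_one)
    have "d q (\<xi> (l * r)) \<le> (1 - l) * L + l * d q (\<xi> r)"
      using dist_to_point_convex[OF geodesic_affine[OF \<xi>, of 0 r] q, of l] l r by (simp add: L_def)
    also have "\<dots> = L + l * e" by (simp add: e_def algebra_simps)
    finally have "(d q (\<xi> (l * r)))\<^sup>2 \<le> (L + l * e)\<^sup>2" by (simp add: power_mono)
    with lower[OF lr] have "L\<^sup>2 + 2 * c * (l * r) \<le> (L + l * e)\<^sup>2" by (simp add: L_def)
    then have "l * (2 * c * r) \<le> l * (2 * L * e + l * e\<^sup>2)"
      by (simp add: power2_eq_square algebra_simps)
    then show ?thesis using l(1) by (rule mult_left_le_imp_le)
  qed
  then have "\<forall>\<^sub>F l in at_right 0. 2 * c * r \<le> 2 * L * e + l * e\<^sup>2"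
    by (auto simp: eventually_at_right_field intro!: exI[of _ 1])
  moreover have "((\<lambda>l. 2 * L * e + l * e\<^sup>2) \<longlongrightarrow> 2 * L * e + 0 * e\<^sup>2) (at_right 0)"
    by (intro tendsto_intros)
  ultimately have "2 * c * r \<le> 2 * L * e + 0 * e\<^sup>2"
    by (intro tendsto_lowerbound) auto
  then have "c * r \<le> L * e" by simp
  then show ?thesis using pos by (simp add: e_def L_def field_simps)
qed

text \<open>In the product, the hypothesis says that \<open>(p, 0)\<close> is the point of the segment from
  \<open>(p, 0)\<close> to \<open>(q, a)\<close> nearest to \<open>(x, c / a)\<close>; symmetry turns this into the conclusion up to an
  error \<open>(r c / a)\<^sup>2\<close>.\<close>
lemma SO_star_swap:
  assumes SO: "SO_star M d" and \<gamma>: "geodesic M d \<gamma>" and \<xi>: "geodesic M d \<xi>" and p: "\<gamma> 0 = \<xi> 0"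
    and lower: "\<And>s. s \<in> {0..1} \<Longrightarrow> (d (\<xi> 1) (\<gamma> 0))\<^sup>2 + 2 * c * s \<le> (d (\<xi> 1) (\<gamma> s))\<^sup>2"
    and r: "r \<in> {0..1}"
  shows "(d (\<gamma> 1) (\<xi> 0))\<^sup>2 + 2 * c * r \<le> (d (\<gamma> 1) (\<xi> r))\<^sup>2"
proof -
  interpret P: Metric_space "M \<times> (UNIV :: real set)" "l2_prod_dist d" by (rule Metric_space_l2_prod)
  have main: "(d (\<gamma> 1) (\<xi> 0))\<^sup>2 + 2 * c * r \<le> (d (\<gamma> 1) (\<xi> r))\<^sup>2 + (r * c)\<^sup>2 * l" if l: "0 < l" for l
  proof -
    \<comment> \<open>The height a satisfies 1/a^2 = l, so the limit of small l lets the tilted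
      geodesic become steep.\<close>
    define a where "a = inverse (sqrt l)"
    have a: "0 < a" "a\<^sup>2 = inverse l" using l by (auto simp: a_def power_inverse)
    define \<Gamma> X where "\<Gamma> = (\<lambda>s. (\<gamma> s, 0 + a * s))" and "X = (\<lambda>t. (\<xi> t, 0 + c / a * t))"
    have G: "geodesic (M \<times> UNIV) (l2_prod_dist d) \<Gamma>" "geodesic (M \<times> UNIV) (l2_prod_dist d) X"
      unfolding \<Gamma>_def X_def by (intro geodesic_l2_prod \<gamma> \<xi>)+
    have X0: "X 0 = \<Gamma> 0" by (simp add: X_def \<Gamma>_def p)
    have foot: "l2_prod_dist d (\<Gamma> 0) (X 1) \<le> l2_prod_dist d (\<Gamma> s) (X 1)" if s: "s \<in> {0..1}" for s
    proof (rule power2_le_imp_le[OF _ l2_prod_dist_nonneg])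
      have "(a * s - c / a)\<^sup>2 = (a * s)\<^sup>2 + (c / a)\<^sup>2 - 2 * c * s"
        using a(1) by (simp add: power2_eq_square field_simps)
      then have "(c / a)\<^sup>2 - 2 * c * s \<le> (a * s - c / a)\<^sup>2"
        using zero_le_power2[of "a * s"] by linarith
      then show "(l2_prod_dist d (\<Gamma> 0) (X 1))\<^sup>2 \<le> (l2_prod_dist d (\<Gamma> s) (X 1))\<^sup>2"
        unfolding l2_prod_dist_sq using lower[OF s] by (simp add: \<Gamma>_def X_def commute)
    qed
    \<comment> \<open>A foot of the end \<open>X 1\<close> is also a foot of every
      \<open>X t\<close>: the triangle inequality through \<open>X t\<close> loses exactly the
      remaining length of X.\<close>
    have "orth (l2_prod_dist d) (\<Gamma> 0) X \<Gamma>"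
      unfolding orth_def
    proof (intro ballI)
      fix s t :: real assume s: "s \<in> {0..1}" and t: "t \<in> {0..1}"
      define D where "D = l2_prod_dist d (\<Gamma> 0) (X 1)"
      have "l2_prod_dist d (\<Gamma> 0) (X t) = t * D" "l2_prod_dist d (X t) (X 1) = (1 - t) * D"
        using geodesic_dist[OF G(2), of 0 t] geodesic_dist[OF G(2), of t 1] t X0 by (auto simp: D_def)
      moreover have "l2_prod_dist d (\<Gamma> s) (X 1) \<le> l2_prod_dist d (\<Gamma> s) (X t) + l2_prod_dist d (X t) (X 1)"
        using geodesic_mem[OF G(1)] geodesic_mem[OF G(2)] s t by (intro P.triangle) auto
      ultimately show "l2_prod_dist d (\<Gamma> 0) (X t) \<le> l2_prod_dist d (\<Gamma> s) (X t)"
        using foot[OF s] by (simp add: D_def algebra_simps)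
    qed
    then have "orth (l2_prod_dist d) (\<Gamma> 0) \<Gamma> X"
      using SO G X0 unfolding SO_star_def SO_prop_def by blast
    then have "(l2_prod_dist d (\<Gamma> 0) (\<Gamma> 1))\<^sup>2 \<le> (l2_prod_dist d (X r) (\<Gamma> 1))\<^sup>2"
      using r l2_prod_dist_nonneg unfolding orth_def by (intro power_mono) auto
    then have "(d (\<gamma> 1) (\<xi> 0))\<^sup>2 + a\<^sup>2 \<le> (d (\<gamma> 1) (\<xi> r))\<^sup>2 + (c / a * r - a)\<^sup>2"
      unfolding l2_prod_dist_sq by (simp add: \<Gamma>_def X_def commute p)
    moreover have "(c / a * r - a)\<^sup>2 = (r * c)\<^sup>2 * inverse (a\<^sup>2) + a\<^sup>2 - 2 * c * r"
      using a(1) by (simp add: power2_eq_square field_simps)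
    ultimately show ?thesis unfolding a(2) by simp
  qed
  have "((\<lambda>l. (d (\<gamma> 1) (\<xi> r))\<^sup>2 + (r * c)\<^sup>2 * l) \<longlongrightarrow> (d (\<gamma> 1) (\<xi> r))\<^sup>2 + (r * c)\<^sup>2 * 0) (at_right 0)"
    by (intro tendsto_intros)
  moreover have "\<forall>\<^sub>F l in at_right 0. (d (\<gamma> 1) (\<xi> 0))\<^sup>2 + 2 * c * r \<le> (d (\<gamma> 1) (\<xi> r))\<^sup>2 + (r * c)\<^sup>2 * l"
    using main by (auto simp: eventually_at_right_field intro!: exI[of _ 1])
  ultimately have "(d (\<gamma> 1) (\<xi> 0))\<^sup>2 + 2 * c * r \<le> (d (\<gamma> 1) (\<xi> r))\<^sup>2 + (r * c)\<^sup>2 * 0"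
    by (intro tendsto_lowerbound) auto
  then show ?thesis by simp
qed

text \<open>Swapping at \<gamma>(0) bounds the distance from \<gamma>(1) along \<xi>; Busemann
  convexity carries the bound to the geodesic \<zeta> from \<gamma>(t) to x; swapping back at
  \<gamma>(t) returns it to \<gamma>. Here t < 1 keeps \<gamma>(t) away from \<gamma>(1).\<close>

lemma slope_increment:
  assumes SO: "SO_star M d" and \<gamma>: "geodesic M d \<gamma>" and A: "0 < d (\<gamma> 0) (\<gamma> 1)" and x: "x \<in> M"
    and slope: "\<And>s. s \<in> {0..1} \<Longrightarrow> (d x (\<gamma> 0))\<^sup>2 + 2 * c * s \<le> (d x (\<gamma> s))\<^sup>2"
    and t: "0 \<le> t" "t < 1" and s: "s \<in> {t..1}"
  shows "(d x (\<gamma> t))\<^sup>2 + 2 * (c + (d (\<gamma> 0) (\<gamma> 1))\<^sup>2 * t) * (s - t) \<le> (d x (\<gamma> s))\<^sup>2"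
proof -
  define L where "L = d (\<gamma> 0) (\<gamma> 1)"
  have L: "0 < L" using A by (simp add: L_def)
  have tI: "t \<in> {0..1}" using t by simp
  have M: "\<gamma> 0 \<in> M" "\<gamma> 1 \<in> M" "\<gamma> t \<in> M" using geodesic_mem[OF \<gamma>] t by auto
  obtain \<xi> where \<xi>: "geodesic M d \<xi>" "\<xi> 0 = \<gamma> 0" "\<xi> 1 = x" using geodesic_between M x by metis
  obtain \<zeta> where \<zeta>: "geodesic M d \<zeta>" "\<zeta> 0 = \<gamma> t" "\<zeta> 1 = x" using geodesic_between M x by metis
  have dt: "d (\<gamma> 0) (\<gamma> t) = t * L" "d (\<gamma> 1) (\<gamma> t) = (1 - t) * L"
    using geodesic_dist[OF \<gamma>, of 0 t] geodesic_dist[OF \<gamma>, of 1 t] t by (auto simp: L_def)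
  have d0: "d (\<gamma> 1) (\<xi> 0) = L" by (simp add: \<xi> L_def commute)
  have \<xi>_lower: "L + c / L * r \<le> d (\<gamma> 1) (\<xi> r)" if "r \<in> {0..1}" for r
    using dist_from_geodesic_linear_bound[OF \<xi>(1) M(2), of c r]
      SO_star_swap[OF SO \<gamma> \<xi>(1), of c] slope that L d0 \<xi> by simp
  \<comment> \<open>The slope along \<zeta>: c / L is inherited from \<xi>, and t * L is the rate at
    which \<xi> and \<zeta> approach each other.\<close>
  define k where "k = c / L + t * L"
  have "((1 - t) * L)\<^sup>2 + 2 * ((1 - t) * L * k) * r \<le> (d (\<gamma> 1) (\<zeta> r))\<^sup>2" if r: "r \<in> {0..1}" for r
  proof -
    have "d (\<gamma> 1) (\<xi> r) \<le> d (\<gamma> 1) (\<zeta> r) + d (\<xi> r) (\<zeta> r)"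
      using triangle[OF M(2) geodesic_mem[OF \<zeta>(1) r] geodesic_mem[OF \<xi>(1) r]] by (simp add: commute)
    moreover have "d (\<xi> r) (\<zeta> r) \<le> (1 - r) * (t * L)"
      using dist_geodesics_convex[OF \<xi>(1) \<zeta>(1) r] by (simp add: \<xi> \<zeta> dt x)
    ultimately have *: "(1 - t) * L + k * r \<le> d (\<gamma> 1) (\<zeta> r)"
      using \<xi>_lower[OF r] by (simp add: k_def algebra_simps)
    define L' where "L' = (1 - t) * L"
    have L': "0 < L'" using t L by (simp add: L'_def)
    have "L'\<^sup>2 + 2 * (L' * k) * r \<le> (d (\<gamma> 1) (\<zeta> r))\<^sup>2"
    \<comment> \<open>A negative lower bound cannot be squared, but then the left side is itself at
      most 0.\<close>
    proof (cases "0 \<le> L' + k * r")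
      case True
      have "L'\<^sup>2 + 2 * (L' * k) * r \<le> L'\<^sup>2 + 2 * (L' * k) * r + (k * r)\<^sup>2" by simp
      also have "\<dots> = (L' + k * r)\<^sup>2" by (simp add: power2_eq_square algebra_simps)
      also have "\<dots> \<le> (d (\<gamma> 1) (\<zeta> r))\<^sup>2" using True * by (intro power_mono) (auto simp: L'_def)
      finally show ?thesis .
    next
      case False
      have "L'\<^sup>2 + 2 * (L' * k) * r = L' * (L' + 2 * (k * r))"
        by (simp add: power2_eq_square algebra_simps)
      also have "\<dots> \<le> 0" using False L' by (intro mult_nonneg_nonpos) auto
      finally show ?thesis using zero_le_power2 order_trans by blast
    qed
    then show ?thesis by (simp add: L'_def)
  qed
  moreover define \<beta> where "\<beta> u = \<gamma> (t + u * (1 - t))" for u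
  have \<beta>: "geodesic M d \<beta>" "\<beta> 0 = \<gamma> t" "\<beta> 1 = \<gamma> 1"
    using geodesic_affine[OF \<gamma> tI, of 1] by (auto simp: \<beta>_def[abs_def])
  ultimately have *: "(d x (\<gamma> t))\<^sup>2 + 2 * ((1 - t) * L * k) * u \<le> (d x (\<beta> u))\<^sup>2" if "u \<in> {0..1}" for u
    using SO_star_swap[OF SO \<zeta>(1) \<beta>(1), of "(1 - t) * L * k" u] that by (simp add: \<zeta> dt)
  define u where "u = (s - t) / (1 - t)"
  have u: "u \<in> {0..1}" "u * (1 - t) = s - t" using t s by (auto simp: u_def field_simps)
  have \<beta>u: "\<beta> u = \<gamma> s" unfolding \<beta>_def u(2) by simp
  have "L * k = c + L\<^sup>2 * t" using L by (simp add: k_def power2_eq_square field_simps)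
  then have "2 * ((1 - t) * L * k) * u = 2 * (c + L\<^sup>2 * t) * (s - t)"
    unfolding u(2)[symmetric] by (metis mult.assoc mult.commute)
  then show ?thesis using *[OF u(1)] unfolding \<beta>u L_def by (simp only:)
qed

text \<open>A Riemann sum: n steps of \<open>slope_increment\<close>, the one from j/n gaining 2 *
  \<open>L\<^sup>2\<close> * j / n^2 beyond the linear term. After k steps the gain is
  \<open>L\<^sup>2\<close> * k * (k - 1) / n^2, and for k = n it tends to
  \<open>L\<^sup>2\<close>.\<close>

lemma strong_convexity_at_end:
  assumes SO: "SO_star M d" and \<gamma>: "geodesic M d \<gamma>" and x: "x \<in> M"
    and slope: "\<And>s. s \<in> {0..1} \<Longrightarrow> (d x (\<gamma> 0))\<^sup>2 + 2 * c * s \<le> (d x (\<gamma> s))\<^sup>2"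
  shows "(d x (\<gamma> 0))\<^sup>2 + 2 * c + (d (\<gamma> 0) (\<gamma> 1))\<^sup>2 \<le> (d x (\<gamma> 1))\<^sup>2"
proof (cases "d (\<gamma> 0) (\<gamma> 1) = 0")
  case True
  then show ?thesis using slope[of 1] by simp
next
  case False
  define L where "L = d (\<gamma> 0) (\<gamma> 1)"
  define F where "F t = (d x (\<gamma> t))\<^sup>2" for t
  have pos: "0 < d (\<gamma> 0) (\<gamma> 1)" using False nonneg[of "\<gamma> 0" "\<gamma> 1"] by linarith
  have bound: "F 0 + 2 * c + L\<^sup>2 * (1 - 1 / real n) \<le> F 1" if n: "0 < n" for n
  proof -
    have steps: "F 0 + 2 * c * (real k / n) + L\<^sup>2 * (real k * (real k - 1) / (real n)\<^sup>2) \<le> F (real k / n)"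
      if "k \<le> n" for k
      using that
    proof (induction k)
      case (Suc k)
      define t h where "t = real k / n" and "h = 1 / real n"
      have s: "real (Suc k) / n = t + h" by (simp add: t_def h_def add_divide_distrib)
      have "F t + 2 * (c + L\<^sup>2 * t) * ((t + h) - t) \<le> F (t + h)"
        unfolding F_def L_def using Suc.prems n
        by (intro slope_increment[OF SO \<gamma> pos x slope])
          (auto simp: s[symmetric] t_def h_def field_simps)
      moreover have "F 0 + 2 * c * t + L\<^sup>2 * (real k * (real k - 1) / (real n)\<^sup>2) \<le> F t"
        using Suc by (simp add: t_def)
      moreover have "real (Suc k) * (real (Suc k) - 1) / (real n)\<^sup>2
          = real k * (real k - 1) / (real n)\<^sup>2 + 2 * t * h"
        using n by (simp add: t_def h_def power2_eq_square field_simps)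
      ultimately show ?case unfolding s by (simp add: algebra_simps)
    qed simp
    have "real n * (real n - 1) / (real n)\<^sup>2 = 1 - 1 / real n"
      using n by (simp add: power2_eq_square field_simps)
    moreover have "real n / n = 1" using n by simp
    ultimately show ?thesis using steps[of n] by simp
  qed
  have "(\<lambda>n. F 0 + 2 * c + L\<^sup>2 * (1 - 1 / real n)) \<longlonglongrightarrow> F 0 + 2 * c + L\<^sup>2 * (1 - 0)"
    by (intro tendsto_intros lim_1_over_n)
  then have "F 0 + 2 * c + L\<^sup>2 * (1 - 0) \<le> F 1"
    by (rule LIMSEQ_le_const2) (use bound in \<open>auto intro!: exI[of _ 1]\<close>)
  then show ?thesis by (simp add: F_def L_def)
qed

lemma SO_star_imp_CN:
  assumes SO: "SO_star M d"
  shows "CN M d"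
proof (rule CNI)
  fix x y z m assume x: "x \<in> M" and "y \<in> M" "z \<in> M" "is_midpoint M d y z m"
  then obtain \<gamma> where \<gamma>: "geodesic M d \<gamma>" "\<gamma> 0 = y" "\<gamma> 1 = z" "\<gamma> (1/2) = m"
    using midpoint_on_geodesic geodesic_space by metis
  let ?F = "\<lambda>t. (d x (\<gamma> t))\<^sup>2"
  obtain c where c: "\<And>t. t \<in> {0..1} \<Longrightarrow> ?F (1/2) + c * (t - 1/2) \<le> ?F t"
    using convex_le_Inf_differential[OF dist_sq_to_point_convex[OF \<gamma>(1) x], of "1/2"] by auto
  \<comment> \<open>Both halves start at the midpoint, the one for v = 0 running backwards. Their
    linear terms are opposite and cancel when the two estimates are averaged.\<close>
  have half: "?F (1/2) + c * (v - 1/2) + (d y z)\<^sup>2 / 4 \<le> ?F v" if v: "v = 0 \<or> v = 1" for v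
  proof -
    let ?\<beta> = "\<lambda>t. \<gamma> (1/2 + t * (v - 1/2))"
    have vI: "v \<in> {0..1}" using v by auto
    have \<beta>: "geodesic M d ?\<beta>" using geodesic_affine[OF \<gamma>(1), of "1/2" v] vI by simp
    \<comment> \<open>\<open>strong_convexity_at_end\<close> takes half the slope as its constant; v
      - 1/2 is the signed speed of this half of \<gamma>.\<close>
    have "(d x (?\<beta> 0))\<^sup>2 + 2 * (c * (v - 1/2) / 2) + (d (?\<beta> 0) (?\<beta> 1))\<^sup>2 \<le> (d x (?\<beta> 1))\<^sup>2"
    proof (rule strong_convexity_at_end[OF SO \<beta> x])
      fix s :: real assume "s \<in> {0..1}"
      moreover have "2 * (c * (v - 1/2) / 2) * s = c * ((1/2 + s * (v - 1/2)) - 1/2)" by simp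
      ultimately show "(d x (?\<beta> 0))\<^sup>2 + 2 * (c * (v - 1/2) / 2) * s \<le> (d x (?\<beta> s))\<^sup>2"
        using c[OF affine_mem_unit[of s "1/2" v]] vI by (simp only:) simp
    qed
    moreover have "d (\<gamma> (1/2)) (\<gamma> v) = d y z / 2"
      using geodesic_dist[OF \<gamma>(1), of "1/2" v] vI v \<gamma> by auto
    ultimately show ?thesis by (simp add: power_divide)
  qed
  show "(d x m)\<^sup>2 \<le> (d x y)\<^sup>2 / 2 + (d x z)\<^sup>2 / 2 - (d y z)\<^sup>2 / 4"
    using half[of 0] half[of 1] \<gamma> by simp
qed

end

section \<open>The cycle of implications\<close>

theorem theorem19:
  fixes M :: "'a set" and d :: "'a \<Rightarrow> 'a \<Rightarrow> real"
  assumes "geodesic_space M d"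
    and "Metric_space.mcomplete M d"
    and "uniformly_inf_convex M d"
  shows "(CAT0 M d \<longleftrightarrow> busemann_convex M d \<and> NE_star M d) \<and>
         (CAT0 M d \<longleftrightarrow> busemann_convex M d \<and> SO_star M d)"
proof -
  interpret Metric_space M d using assms(1) unfolding geodesic_space_def by simp
  interpret P: Metric_space "M \<times> (UNIV :: real set)" "l2_prod_dist d" by (rule Metric_space_l2_prod)
  have "busemann_convex M d \<and> NE_star M d" if "CAT0 M d"
    using that CN_imp_busemann P.CN_imp_NE[OF CN_l2_prod geodesic_space_l2_prod[OF assms(1)]]
    unfolding CAT0_iff_CN NE_star_def by blast
  moreover have "SO_star M d" if "NE_star M d"
    using that P.NE_imp_SO unfolding NE_star_def SO_star_def by blast
  moreover have "CAT0 M d" if "busemann_convex M d" "SO_star M d"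
  proof -
    interpret busemann_space M d by unfold_locales (use assms(1) that in auto)
    show ?thesis using SO_star_imp_CN[OF that(2)] CAT0_iff_CN by simp
  qed
  ultimately show ?thesis by blast
qed

end
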